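(* Let $r \ge 4$ and $t \ge 3$ be integers with $r \le 2t-2$, and let $K(r,t)$ be the matroid on $[2t+2]$ whose circuit set is $\mathcal{C}(r,t)$. There is no matroid $N$ on the set of circuits of $K(r,t)/\{2t+1,2t+2\}$, satisfying the modular-pair condition with respect to $K(r,t)/\{2t+1,2t+2\}$, for which $K(r,t)\setminus\{2t+1,2t+2\}$ is isomorphic to $(K(r,t)/\{2t+1,2t+2\})^N$. Moreover, $K(r,t)$ is not representable over any field.
   Context: For $i=1,\dots,t$ let $C_i\subseteq[2t]$ be the set of the $r-2$ consecutive integers $2i-1, 2i, \dots, 2i+r-4$, each reduced modulo $2t$ to a representative in $\{1,\dots,2t\}$. Let $X=\{2t+1,2t+2\}$, $\mathcal{C}'(r,t) = \{C_i\cup X : i\in[t]\}$, $\mathcal{C}''(r,t) = \{C_i\cup C_{i+1} : i\in[t-1]\}$, and let $\mathcal{C}(r,t)$ consist of all sets in $\mathcal{C}'(r,t)\cup\mathcal{C}''(r,t)$ together with all $(r+1)$-element subsets of $[2t+2]$ containing no member of $\mathcal{C}'(r,t)\cup\mathcal{C}''(r,t)$; this is the circuit set of a rank-$r$ sparse paving matroid $K(r,t)$ on $[2t+2]$. For a matroid $M$ on ground set $E$ and a matroid $N$ whose ground set is the set of circuits of $M$, $N$ satisfies the modular-pair condition if whenever $C_1,C_2$ are circuits of $M$ with $|C_1\cup C_2| - r_M(C_1\cup C_2) = 2$, every circuit $C$ of $M$ contained in $C_1\cup C_2$ satisfies $C\in\operatorname{cl}_N(\{C_1,C_2\})$; then $M^N$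 denotes the matroid on $E$ with rank function $r(Y) = r_M(Y) + r_N(\{C : C \text{ a circuit of } M,\ C\subseteq Y\})$.
   Formalization: "Isomorphic" is taken to mean isomorphic by a bijection of the ground set that is also an automorphism of K(r,t)/{2t+1,2t+2} (equality included); with arbitrary matroid isomorphism the first claim is false, e.g. for r=4, t=3. *)

theory Defs
  imports Complex_Main "HOL-Library.Function_Algebras"
begin

section \<open>Finite matroids\<close>

record 'a matroid_struct =
  ground :: "'a set"
  indep :: "'a set set"

definition matroid :: "'a matroid_struct \<Rightarrow> bool" where
  "matroid M \<longleftrightarrow>
     finite (ground M) \<and>
     (\<forall>I\<in>indep M. I \<subseteq> ground M) \<and>
     {} \<in> indep M \<and>
     (\<forall>I\<in>indep M. \<forall>J. J \<subseteq> I \<longrightarrow> J \<in> indep M) \<and>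
     (\<forall>I\<in>indep M. \<forall>J\<in>indep M. card I < card J \<longrightarrow> (\<exists>e\<in>J - I. insert e I \<in> indep M))"

definition rank :: "'a matroid_struct \<Rightarrow> 'a set \<Rightarrow> nat" where
  "rank M Y = Max (card ` {I \<in> indep M. I \<subseteq> Y})"

definition circuits :: "'a matroid_struct \<Rightarrow> 'a set set" where
  "circuits M = {C. C \<subseteq> ground M \<and> C \<notin> indep M \<and> (\<forall>D. D \<subset> C \<longrightarrow> D \<in> indep M)}"

definition cl :: "'a matroid_struct \<Rightarrow> 'a set \<Rightarrow> 'a set" where
  "cl M Y = {e \<in> ground M. rank M (insert e Y) = rank M Y}"

definition matroid_of_circuits :: "'a set \<Rightarrow> 'a set set \<Rightarrow> 'a matroid_struct" where
  "matroid_of_circuits E \<C> = \<lparr>ground = E, indep = {I. I \<subseteq> E \<and> \<not> (\<exists>C\<in>\<C>. C \<subseteq> I)}\<rparr>"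

definition matroid_of_rank :: "'a set \<Rightarrow> ('a set \<Rightarrow> nat) \<Rightarrow> 'a matroid_struct" where
  "matroid_of_rank E \<rho> = \<lparr>ground = E, indep = {I. I \<subseteq> E \<and> \<rho> I = card I}\<rparr>"

definition deletion :: "'a matroid_struct \<Rightarrow> 'a set \<Rightarrow> 'a matroid_struct" where
  "deletion M X = \<lparr>ground = ground M - X, indep = {I \<in> indep M. I \<subseteq> ground M - X}\<rparr>"

definition contraction :: "'a matroid_struct \<Rightarrow> 'a set \<Rightarrow> 'a matroid_struct" where
  "contraction M X = matroid_of_rank (ground M - X) (\<lambda>Y. rank M (Y \<union> X) - rank M X)"

definition isomorphism :: "('a \<Rightarrow> 'b) \<Rightarrow> 'a matroid_struct \<Rightarrow> 'b matroid_struct \<Rightarrow> bool" where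
  "isomorphism \<phi> M N \<longleftrightarrow>
     bij_betw \<phi> (ground M) (ground N) \<and>
     (\<forall>I. I \<subseteq> ground M \<longrightarrow> (I \<in> indep M \<longleftrightarrow> \<phi> ` I \<in> indep N))"

text \<open>
  A representation over the field \<open>'f\<close> assigns to each element \<open>e\<close> a column \<open>v e\<close> of a
  matrix over \<open>'f\<close>; a set is independent iff its columns form a linearly independent family,
  i.e. are pairwise distinct and form a linearly independent set. Columns are functions
  \<open>nat \<Rightarrow> 'f\<close>, so the number of rows is not bounded in advance.
\<close>

definition representable_over :: "'f::field itself \<Rightarrow> 'a matroid_struct \<Rightarrow> bool" where
  "representable_over _ M \<longleftrightarrow>
     (\<exists>v :: 'a \<Rightarrow> nat \<Rightarrow> 'f. \<forall>I. I \<subseteq> ground M \<longrightarrow>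
        (I \<in> indep M \<longleftrightarrow>
          inj_on v I \<and> \<not> module.dependent (\<lambda>c x i. c * x i) (v ` I)))"

lemma vector_space_columns: "vector_space (\<lambda>(c::'f::field) (x::nat \<Rightarrow> 'f) i. c * x i)"
  by unfold_locales (auto simp: fun_eq_iff algebra_simps)


section \<open>Lifts from matroids on the set of circuits\<close>

definition modular_pair_condition :: "'a matroid_struct \<Rightarrow> 'a set matroid_struct \<Rightarrow> bool" where
  "modular_pair_condition M N \<longleftrightarrow>
     (\<forall>C\<^sub>1\<in>circuits M. \<forall>C\<^sub>2\<in>circuits M.
        card (C\<^sub>1 \<union> C\<^sub>2) = rank M (C\<^sub>1 \<union> C\<^sub>2) + 2 \<longrightarrow>
        (\<forall>C\<in>circuits M. C \<subseteq> C\<^sub>1 \<union> C\<^sub>2 \<longrightarrow> C \<in> cl N {C\<^sub>1, C\<^sub>2}))"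

definition circuit_lift :: "'a matroid_struct \<Rightarrow> 'a set matroid_struct \<Rightarrow> 'a matroid_struct" where
  "circuit_lift M N =
     matroid_of_rank (ground M) (\<lambda>Y. rank M Y + rank N {C \<in> circuits M. C \<subseteq> Y})"

text \<open>
  Isomorphism of two matroids \<open>L\<^sub>1\<close>, \<open>L\<^sub>2\<close> regarded as lifts of the same matroid \<open>M\<close>: the
  isomorphism \<open>L\<^sub>1 \<rightarrow> L\<^sub>2\<close> must also preserve \<open>M\<close>. This includes equality of \<open>L\<^sub>1\<close> and \<open>L\<^sub>2\<close>.
  Arbitrary relabellings of the ground set that disregard \<open>M\<close> must be excluded: for \<open>K\<close> below
  with \<open>r = 4\<close> and \<open>t = 3\<close>, let \<open>N\<close> be the loopless rank-2 matroid on the circuits of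
  \<open>K / {7, 8}\<close> whose only nontrivial parallel classes are the circuits inside \<open>{1, 2, 3, 5}\<close>
  and the circuits inside \<open>{1, 3, 4, 6}\<close>. It satisfies the modular-pair condition, and
  \<open>circuit_lift (K / {7, 8}) N\<close> and the deletion of \<open>{7, 8}\<close> from \<open>K\<close> are both rank-4 sparse
  paving matroids on 6 elements with exactly two circuit-hyperplanes, hence abstractly isomorphic.
\<close>

definition isomorphic_lifts ::
    "'a matroid_struct \<Rightarrow> 'a matroid_struct \<Rightarrow> 'a matroid_struct \<Rightarrow> bool" where
  "isomorphic_lifts M L\<^sub>1 L\<^sub>2 \<longleftrightarrow> (\<exists>\<phi>. isomorphism \<phi> L\<^sub>1 L\<^sub>2 \<and> isomorphism \<phi> M M)"

lemma isomorphic_lifts_refl: "ground L = ground M \<Longrightarrow> isomorphic_lifts M L L"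
  unfolding isomorphic_lifts_def isomorphism_def by (intro exI[of _ id]) simp


section \<open>The matroids K(r,t)\<close>

text \<open>\<open>cyc_block r t i\<close> is the set $C_i$; it is only used for \<open>r \<ge> 4\<close> and \<open>i \<ge> 1\<close>, where the
  truncated subtractions are exact.\<close>

definition cyc_block :: "nat \<Rightarrow> nat \<Rightarrow> nat \<Rightarrow> nat set" where
  "cyc_block r t i = (\<lambda>k. (k - 1) mod (2 * t) + 1) ` {2 * i - 1..2 * i + r - 4}"

definition K_X :: "nat \<Rightarrow> nat set" where
  "K_X t = {2 * t + 1, 2 * t + 2}"

definition K_circuits' :: "nat \<Rightarrow> nat \<Rightarrow> nat set set" where
  "K_circuits' r t = {cyc_block r t i \<union> K_X t | i. i \<in> {1..t}}"

definition K_circuits'' :: "nat \<Rightarrow> nat \<Rightarrow> nat set set" where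
  "K_circuits'' r t = {cyc_block r t i \<union> cyc_block r t (i + 1) | i. i \<in> {1..t - 1}}"

definition K_circuits :: "nat \<Rightarrow> nat \<Rightarrow> nat set set" where
  "K_circuits r t = K_circuits' r t \<union> K_circuits'' r t \<union>
     {Y. Y \<subseteq> {1..2 * t + 2} \<and> card Y = r + 1 \<and>
         \<not> (\<exists>D \<in> K_circuits' r t \<union> K_circuits'' r t. D \<subseteq> Y)}"

definition K_matroid :: "nat \<Rightarrow> nat \<Rightarrow> nat matroid_struct" where
  "K_matroid r t = matroid_of_circuits {1..2 * t + 2} (K_circuits r t)"

end

theory Submission
  imports Defs
begin

text \<open>
  Write \<open>X = {2t+1, 2t+2}\<close>. For \<open>i < t\<close> the modular pair \<open>C\<^sub>i, C\<^sub>i\<^sub>+\<^sub>1\<close> of circuits of \<open>K/X\<close> has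
  a union that is dependent in \<open>K \ X\<close>; if \<open>K \ X\<close> were the lift given by \<open>N\<close>, this would make
  \<open>C\<^sub>i\<close> and \<open>C\<^sub>i\<^sub>+\<^sub>1\<close> parallel in \<open>N\<close>. Parallelism is transitive, so \<open>C\<^sub>t\<close> and \<open>C\<^sub>1\<close> are parallel,
  contradicting the independence of \<open>C\<^sub>t \<union> C\<^sub>1\<close> in \<open>K \ X\<close>.

  A representation yields the same contradiction with \<open>N\<close> replaced by points of a projective
  line: each circuit \<open>C\<^sub>i \<union> X\<close> carries a linear relation, unique up to scaling, and its pair of
  coefficients on \<open>X\<close> plays the role of the element \<open>C\<^sub>i\<close> of \<open>N\<close>.
\<close>

section \<open>Rank, contraction and isomorphism\<close>

lemma card_le_rank:
  assumes "finite Y" "I \<in> indep M" "I \<subseteq> Y"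
  shows "card I \<le> rank M Y"
  unfolding rank_def using assms by (intro Max_ge) auto

lemma rank_attained:
  assumes "finite Y" "{} \<in> indep M"
  obtains I where "I \<in> indep M" "I \<subseteq> Y" "card I = rank M Y"
proof -
  have "rank M Y \<in> card ` {I \<in> indep M. I \<subseteq> Y}"
    unfolding rank_def using assms by (intro Max_in) auto
  then show ?thesis using that by auto
qed

lemma rank_le_card:
  assumes "finite Y" "{} \<in> indep M"
  shows "rank M Y \<le> card Y"
  by (metis assms card_mono rank_attained)

lemma rank_eq_card_iff:
  assumes "finite Y" "{} \<in> indep M"
  shows "rank M Y = card Y \<longleftrightarrow> Y \<in> indep M"
proof
  assume "rank M Y = card Y"
  then show "Y \<in> indep M" by (metis assms card_subset_eq rank_attained)
next
  assume "Y \<in> indep M"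
  then show "rank M Y = card Y"
    using assms card_le_rank[of Y Y M] rank_le_card[of Y M] by simp
qed

text \<open>As \<open>X\<close> is independent, its rank is its size, and it bounds the rank of
  \<open>I \<union> X\<close> from below. The truncated subtraction in \<open>contraction\<close> is
  therefore exact, and full rank of \<open>I\<close> in the contraction amounts to full rank of
  \<open>I \<union> X\<close> in \<open>M\<close>.\<close>

lemma indep_contraction:
  assumes "finite (ground M)" "{} \<in> indep M" "X \<in> indep M" "X \<subseteq> ground M"
  shows "I \<in> indep (contraction M X) \<longleftrightarrow> I \<subseteq> ground M - X \<and> I \<union> X \<in> indep M"
proof (cases "I \<subseteq> ground M - X")
  case True
  have fin: "finite X" "finite (I \<union> X)"
    using True assms by (meson Diff_subset finite_Un finite_subset)+
  have "I \<inter> X = {}" using True by blast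
  then have "card (I \<union> X) = card I + card X"
    using fin by (simp add: card_Un_disjoint)
  moreover have "rank M X = card X" using rank_eq_card_iff[OF fin(1) assms(2)] assms(3) by blast
  moreover have "card X \<le> rank M (I \<union> X)" using card_le_rank fin(2) assms(3) by blast
  ultimately have "rank M (I \<union> X) - rank M X = card I \<longleftrightarrow> rank M (I \<union> X) = card (I \<union> X)"
    by linarith
  then show ?thesis
    using True rank_eq_card_iff[OF fin(2) assms(2)]
    by (auto simp: contraction_def matroid_of_rank_def)
qed (auto simp: contraction_def matroid_of_rank_def)

lemma rank_isomorphism:
  assumes "isomorphism \<phi> M N" "Y \<subseteq> ground M"
  shows "rank N (\<phi> ` Y) = rank M Y"
proof -
  have inj: "inj_on \<phi> (ground M)" using assms(1) by (simp add: isomorphism_def bij_betw_def)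
  have iff: "I \<in> indep M \<longleftrightarrow> \<phi> ` I \<in> indep N" if "I \<subseteq> Y" for I
    using assms that by (auto simp: isomorphism_def)
  have "{J \<in> indep N. J \<subseteq> \<phi> ` Y} = (`) \<phi> ` {I \<in> indep M. I \<subseteq> Y}"
  proof (intro equalityI subsetI)
    fix J assume "J \<in> {J \<in> indep N. J \<subseteq> \<phi> ` Y}"
    then obtain I where "I \<subseteq> Y" "J = \<phi> ` I" "J \<in> indep N" by (auto simp: subset_image_iff)
    then show "J \<in> (`) \<phi> ` {I \<in> indep M. I \<subseteq> Y}" using iff by blast
  qed (use iff in auto)
  then have "card ` {J \<in> indep N. J \<subseteq> \<phi> ` Y} = (\<lambda>I. card (\<phi> ` I)) ` {I \<in> indep M. I \<subseteq> Y}"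
    by (simp add: image_image)
  also have "\<dots> = card ` {I \<in> indep M. I \<subseteq> Y}"
    using inj assms(2) by (intro image_cong) (auto intro!: card_image intro: inj_on_subset)
  finally show ?thesis by (simp add: rank_def)
qed

lemma circuit_isomorphism:
  assumes "isomorphism \<phi> M N" "C \<in> circuits M"
  shows "\<phi> ` C \<in> circuits N"
proof -
  have C: "C \<subseteq> ground M" "C \<notin> indep M" "\<And>D. D \<subset> C \<Longrightarrow> D \<in> indep M"
    using assms(2) by (auto simp: circuits_def)
  have "D \<in> indep N" if D: "D \<subset> \<phi> ` C" for D
  proof -
    obtain B where "B \<subseteq> C" "D = \<phi> ` B" using D by (meson psubset_imp_subset subset_imageE)
    then show ?thesis using C D assms(1) by (auto simp: isomorphism_def)
  qed
  then show ?thesis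
    using C(1,2) assms(1) image_mono[OF C(1), of \<phi>]
    by (simp add: circuits_def isomorphism_def bij_betw_def)
qed

section \<open>Closure, parallel elements and circuit lifts\<close>

lemma circuit_subset_eq:
  assumes "C \<in> circuits M" "D \<in> circuits M" "C \<subseteq> D"
  shows "C = D"
  using assms by (auto simp: circuits_def)

text \<open>If \<open>S\<close> had larger rank, a maximum independent subset of \<open>Y\<close>
  could be augmented by some \<open>e\<close> in \<open>S\<close>. That raises the rank of
  \<open>insert e Y\<close> above that of \<open>Y\<close>, although \<open>e\<close> lies in the
  closure.\<close>

lemma rank_eq_of_subset_cl:
  assumes N: "matroid N" and S: "finite S" "Y \<subseteq> S" "S \<subseteq> cl N Y"
  shows "rank N S = rank N Y"
proof (rule antisym)
  have emp: "{} \<in> indep N" using N by (simp add: matroid_def)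
  have fY: "finite Y" using S finite_subset by blast
  obtain B where B: "B \<in> indep N" "B \<subseteq> Y" "card B = rank N Y"
    using rank_attained[OF fY emp] .
  show "rank N Y \<le> rank N S" using card_le_rank[of S B N] S B by auto
  show "rank N S \<le> rank N Y"
  proof (rule ccontr)
    assume less: "\<not> rank N S \<le> rank N Y"
    obtain J where J: "J \<in> indep N" "J \<subseteq> S" "card J = rank N S"
      using rank_attained[OF S(1) emp] .
    obtain e where e: "e \<in> J - B" "insert e B \<in> indep N"
      using N J(1,3) B(1,3) less unfolding matroid_def by (metis not_le)
    have "card (insert e B) \<le> rank N (insert e Y)"
      using card_le_rank e(2) B(2) fY by (meson finite_insert insert_mono)
    moreover have "card (insert e B) = Suc (card B)"
      using e B fY by (meson DiffD2 card_insert_disjoint finite_subset)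
    moreover have "rank N (insert e Y) = rank N Y" using e J S by (auto simp: cl_def)
    ultimately show False using B(3) by simp
  qed
qed

text \<open>Augmenting \<open>{b}\<close> from an independent \<open>{a, c}\<close> would make
  \<open>{a, b}\<close> or \<open>{b, c}\<close> independent.\<close>

lemma parallel_trans:
  assumes "matroid N" "{b} \<in> indep N" "{a, b} \<notin> indep N" "{b, c} \<notin> indep N" "a \<noteq> c"
  shows "{a, c} \<notin> indep N"
proof
  assume ac: "{a, c} \<in> indep N"
  have "card {b} < card {a, c}" using assms by simp
  then obtain e where "e \<in> {a, c} - {b}" "insert e {b} \<in> indep N"
    using assms(1)[unfolded matroid_def] assms(2) ac by metis
  then show False using assms(3,4) by (auto simp: insert_commute)
qed

text \<open>The only circuit of \<open>M\<close> inside \<open>C\<close> is \<open>C\<close> itself,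
  so the rank missing in \<open>M\<close> has to come from \<open>{C}\<close> alone; hence
  \<open>C\<close> is not a loop of \<open>N\<close>.\<close>

lemma circuit_indep_circuit_lift:
  assumes M: "finite (ground M)" "{} \<in> indep M" and N: "{} \<in> indep N"
    and C: "C \<in> circuits M" "C \<in> indep (circuit_lift M N)"
  shows "{C} \<in> indep N"
proof -
  have fC: "finite C" "C \<notin> indep M" using C M by (auto simp: circuits_def intro: finite_subset)
  have "{D \<in> circuits M. D \<subseteq> C} = {C}" using C(1) circuit_subset_eq by fastforce
  then have "rank M C + rank N {C} = card C"
    using C(2) by (simp add: circuit_lift_def matroid_of_rank_def)
  moreover have "rank M C < card C"
    using rank_le_card rank_eq_card_iff fC M(2) by (metis le_neq_implies_less)
  moreover have "rank N {C} \<le> card {C}" using rank_le_card N by blast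
  ultimately have "rank N {C} = card {C}" by simp
  then show ?thesis using rank_eq_card_iff N by blast
qed

text \<open>By the modular-pair condition all circuits inside the union lie in the closure of the
  pair, so \<open>N\<close> contributes exactly the rank of the pair. The union falls short of full
  rank in \<open>M\<close> by 2, which the pair makes up only if it is independent.\<close>

lemma modular_pair_indep_circuit_lift:
  assumes M: "finite (ground M)" and N: "matroid N" "ground N = circuits M"
    and mpc: "modular_pair_condition M N"
    and C: "C\<^sub>1 \<in> circuits M" "C\<^sub>2 \<in> circuits M" "C\<^sub>1 \<noteq> C\<^sub>2"
    and mp: "card (C\<^sub>1 \<union> C\<^sub>2) = rank M (C\<^sub>1 \<union> C\<^sub>2) + 2"
  shows "C\<^sub>1 \<union> C\<^sub>2 \<in> indep (circuit_lift M N) \<longleftrightarrow> {C\<^sub>1, C\<^sub>2} \<in> indep N"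
proof -
  let ?S = "{C \<in> circuits M. C \<subseteq> C\<^sub>1 \<union> C\<^sub>2}"
  have emp: "{} \<in> indep N" using N by (simp add: matroid_def)
  have "finite ?S" using N by (simp add: matroid_def)
  moreover have "{C\<^sub>1, C\<^sub>2} \<subseteq> ?S" using C by auto
  moreover have "?S \<subseteq> cl N {C\<^sub>1, C\<^sub>2}" using mpc C mp by (auto simp: modular_pair_condition_def)
  ultimately have "rank N ?S = rank N {C\<^sub>1, C\<^sub>2}" by (rule rank_eq_of_subset_cl[OF N(1)])
  moreover have "C\<^sub>1 \<union> C\<^sub>2 \<subseteq> ground M" using C by (auto simp: circuits_def)
  ultimately have "C\<^sub>1 \<union> C\<^sub>2 \<in> indep (circuit_lift M N) \<longleftrightarrow> rank N {C\<^sub>1, C\<^sub>2} = card {C\<^sub>1, C\<^sub>2}"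
    using mp C(3) by (simp add: circuit_lift_def matroid_of_rank_def numeral_2_eq_2)
  then show ?thesis using rank_eq_card_iff[of "{C\<^sub>1, C\<^sub>2}" N] emp by simp
qed

section \<open>Linear relations of a representation\<close>

lemma (in vector_space) independent_family_iff:
  assumes "finite I"
  shows "inj_on v I \<and> independent (v ` I) \<longleftrightarrow>
    (\<forall>c. (\<Sum>e\<in>I. c e *s v e) = 0 \<longrightarrow> (\<forall>e\<in>I. c e = 0))"
proof
  assume L: "inj_on v I \<and> independent (v ` I)"
  show "\<forall>c. (\<Sum>e\<in>I. c e *s v e) = 0 \<longrightarrow> (\<forall>e\<in>I. c e = 0)"
  proof (intro allI impI ballI)
    fix c e assume c: "(\<Sum>e\<in>I. c e *s v e) = 0" and e: "e \<in> I"
    \<comment> \<open>Injectivity of \<open>v\<close> lets coefficients indexed by \<open>I\<close>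
      be carried over to the set \<open>v\<close> + "I", where independence of sets applies.\<close>
    have "(\<Sum>w\<in>v ` I. c (inv_into I v w) *s w) = (\<Sum>e\<in>I. c e *s v e)"
      using L by (simp add: sum.reindex)
    then have "(\<Sum>w\<in>v ` I. c (inv_into I v w) *s w) = 0" using c by simp
    moreover have "\<forall>u. (\<Sum>w\<in>v ` I. u w *s w) = 0 \<longrightarrow> (\<forall>w\<in>v ` I. u w = 0)"
      using L assms dependent_finite[of "v ` I"] by blast
    from this[THEN spec, of "\<lambda>w. c (inv_into I v w)"]
    have "(\<Sum>w\<in>v ` I. c (inv_into I v w) *s w) = 0 \<longrightarrow> (\<forall>w\<in>v ` I. c (inv_into I v w) = 0)" .
    ultimately have "\<forall>w\<in>v ` I. c (inv_into I v w) = 0" by blast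
    then have "c (inv_into I v (v e)) = 0" using e by (rule bspec[OF _ imageI])
    then show "c e = 0" using L e by simp
  qed
next
  assume R: "\<forall>c. (\<Sum>e\<in>I. c e *s v e) = 0 \<longrightarrow> (\<forall>e\<in>I. c e = 0)"
  have inj: "inj_on v I"
  proof (rule inj_onI, rule ccontr)
    fix a b assume ab: "a \<in> I" "b \<in> I" "v a = v b" "a \<noteq> b"
    \<comment> \<open>Two equal vectors cancel with coefficients 1 and -1, a nontrivial
      relation.\<close>
    define c where "c = (\<lambda>e. if e = a then 1 else if e = b then - 1 else 0 :: 'a)"
    have "(\<Sum>e\<in>I. c e *s v e) = (\<Sum>e\<in>{a, b}. c e *s v e)"
      using ab assms by (intro sum.mono_neutral_right) (auto simp: c_def)
    also have "\<dots> = 0" using ab by (simp add: c_def)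
    finally have "c a = 0" using R ab(1) by blast
    then show False by (simp add: c_def)
  qed
  have "u w = 0" if "(\<Sum>w\<in>v ` I. u w *s w) = 0" "w \<in> v ` I" for u w
  proof -
    have "(\<Sum>e\<in>I. u (v e) *s v e) = 0" using that(1) inj by (simp add: sum.reindex)
    then show ?thesis using R that(2) by auto
  qed
  then show "inj_on v I \<and> independent (v ` I)"
    using inj assms dependent_finite[of "v ` I"] by auto
qed

lemma sum_apply: "(\<Sum>e\<in>A. f e) x = (\<Sum>e\<in>A. f e x)"
  for f :: "'a \<Rightarrow> 'b \<Rightarrow> 'c::comm_monoid_add"
  by (induction A rule: infinite_finite_induct) simp_all

text \<open>Replaces the vectors by the space \<open>R\<close> of their linear relations: a set is
  independent iff only the zero relation is supported on it. Coordinates can then be eliminated by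
  taking linear combinations inside \<open>R\<close>.\<close>

lemma representable_relations:
  fixes M :: "'a matroid_struct"
  assumes fin: "finite (ground M)" and rep: "representable_over TYPE('f::field) M"
  obtains R :: "('a \<Rightarrow> 'f::field) set" where
    "\<forall>c\<in>R. \<forall>d\<in>R. \<forall>\<alpha> \<beta>. (\<lambda>e. \<alpha> * c e + \<beta> * d e) \<in> R"
    "\<forall>I\<subseteq>ground M.
      I \<in> indep M \<longleftrightarrow> (\<forall>c\<in>R. (\<forall>e. e \<notin> I \<longrightarrow> c e = 0) \<longrightarrow> (\<forall>e. c e = 0))"
proof -
  let ?s = "\<lambda>(c::'f) (x::nat \<Rightarrow> 'f) i. c * x i"
  interpret vs: vector_space ?s by (rule vector_space_columns)
  obtain v :: "'a \<Rightarrow> nat \<Rightarrow> 'f" where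
    v: "\<And>I. I \<subseteq> ground M \<Longrightarrow> I \<in> indep M \<longleftrightarrow> inj_on v I \<and> vs.independent (v ` I)"
    using rep by (auto simp: representable_over_def)
  \<comment> \<open>Relations are zero outside the ground set, so that supports can be stated over
    the whole type.\<close>
  define R where
    "R = {c. (\<forall>e. e \<notin> ground M \<longrightarrow> c e = 0) \<and> (\<Sum>e\<in>ground M. ?s (c e) (v e)) = 0}"
  show ?thesis
  proof (rule that[of R]; intro ballI allI impI)
    fix c d :: "'a \<Rightarrow> 'f" and \<alpha> \<beta> assume "c \<in> R" "d \<in> R"
    moreover have "(\<Sum>e\<in>ground M. ?s (\<alpha> * c e + \<beta> * d e) (v e)) =
        ?s \<alpha> (\<Sum>e\<in>ground M. ?s (c e) (v e)) + ?s \<beta> (\<Sum>e\<in>ground M. ?s (d e) (v e))"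
      by (rule ext) (simp add: sum_apply sum_distrib_left sum.distrib[symmetric] algebra_simps)
    ultimately show "(\<lambda>e. \<alpha> * c e + \<beta> * d e) \<in> R"
      by (auto simp: R_def fun_eq_iff)
  next
    fix I assume I: "I \<subseteq> ground M"
    have sum_I: "(\<Sum>e\<in>ground M. ?s (c e) (v e)) = (\<Sum>e\<in>I. ?s (c e) (v e))"
      if "\<forall>e. e \<notin> I \<longrightarrow> c e = 0" for c
      using that I fin by (intro sum.mono_neutral_right) (auto simp: fun_eq_iff)
    have "I \<in> indep M \<longleftrightarrow> (\<forall>c. (\<Sum>e\<in>I. ?s (c e) (v e)) = 0 \<longrightarrow> (\<forall>e\<in>I. c e = 0))"
      using v[OF I] vs.independent_family_iff[of I v] finite_subset[OF I fin] by simp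
    also have "\<dots> \<longleftrightarrow> (\<forall>c\<in>R. (\<forall>e. e \<notin> I \<longrightarrow> c e = 0) \<longrightarrow> (\<forall>e. c e = 0))"
    proof (intro iffI ballI allI impI)
      fix c e assume H: "\<forall>c. (\<Sum>e\<in>I. ?s (c e) (v e)) = 0 \<longrightarrow> (\<forall>e\<in>I. c e = 0)"
        and c: "c \<in> R" "\<forall>e. e \<notin> I \<longrightarrow> c e = 0"
      then have "(\<Sum>e\<in>I. ?s (c e) (v e)) = 0" using sum_I[OF c(2)] by (simp add: R_def)
      then show "c e = 0" using H c(2) by blast
    next
      fix c e assume H: "\<forall>c\<in>R. (\<forall>e. e \<notin> I \<longrightarrow> c e = 0) \<longrightarrow> (\<forall>e. c e = 0)"
        and c: "(\<Sum>e\<in>I. ?s (c e) (v e)) = 0" and e: "e \<in> I"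
      define d where "d = (\<lambda>e. if e \<in> I then c e else 0)"
      have "(\<Sum>e\<in>I. ?s (d e) (v e)) = 0" using c by (simp add: d_def)
      then have "d \<in> R" using sum_I[of d] I by (auto simp: R_def d_def)
      moreover have "\<forall>e. e \<notin> I \<longrightarrow> d e = 0" by (simp add: d_def)
      ultimately have "d e = 0" using H by blast
      then show "c e = 0" using e by (simp add: d_def)
    qed
    finally show "I \<in> indep M \<longleftrightarrow> (\<forall>c\<in>R. (\<forall>e. e \<notin> I \<longrightarrow> c e = 0) \<longrightarrow> (\<forall>e. c e = 0))" .
  qed
qed

section \<open>Arithmetic of the cyclic blocks\<close>

locale K_parameters =
  fixes r t :: nat
  assumes r_ge: "r \<ge> 4" and t_ge: "t \<ge> 3" and r_le: "r \<le> 2 * t - 2"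
begin

definition wrap :: "nat \<Rightarrow> nat" where
  "wrap k = (k - 1) mod (2 * t) + 1"

abbreviation block :: "nat \<Rightarrow> nat set" where
  "block \<equiv> cyc_block r t"

text \<open>At most \<open>2 * t\<close> consecutive integers meet each residue class at most
  once.\<close>

lemma inj_on_wrap:
  assumes "1 \<le> a" "b \<le> a + 2 * t - 1"
  shows "inj_on wrap {a..b}"
proof (rule linorder_inj_onI)
  fix x y assume xy: "x < y" "x \<in> {a..b}" "y \<in> {a..b}"
  show "wrap x \<noteq> wrap y"
  proof
    assume "wrap x = wrap y"
    then have "2 * t dvd (y - 1) - (x - 1)"
      using xy by (intro mod_eq_dvd_iff_nat[THEN iffD1]) (auto simp: wrap_def)
    then show False using xy assms by (auto dest!: dvd_imp_le)
  qed
qed auto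

lemma block_eq: "block i = wrap ` {2 * i - 1..2 * i + r - 4}"
  by (simp add: cyc_block_def wrap_def)

lemma block_subset: "block i \<subseteq> {1..2 * t}"
  using t_ge mod_less_divisor[of "2 * t"] by (auto simp: block_eq wrap_def Suc_le_eq)

lemma finite_block [simp]: "finite (block i)"
  by (simp add: block_eq)

lemma card_block:
  assumes "i \<ge> 1"
  shows "card (block i) = r - 2"
  unfolding block_eq using assms r_ge r_le t_ge
  by (subst card_image) (auto intro!: inj_on_wrap)

text \<open>The intervals start two apart and have length at least 2, so together they leave no
  gap.\<close>

lemma block_Un_block:
  assumes "i \<ge> 1"
  shows "block i \<union> block (Suc i) = wrap ` {2 * i - 1..2 * i + r - 2}"
proof -
  have "{2 * i - 1..2 * i + r - 2} = {2 * i - 1..2 * i + r - 4} \<union> {2 * Suc i - 1..2 * Suc i + r - 4}"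
    using assms r_ge by auto
  then show ?thesis by (simp only: block_eq image_Un)
qed

lemma card_block_Un_block:
  assumes "i \<ge> 1"
  shows "card (block i \<union> block (Suc i)) = r"
  unfolding block_Un_block[OF assms] using assms r_ge r_le t_ge
  by (subst card_image) (auto intro!: inj_on_wrap)

text \<open>Allows the pair closing the cycle to be treated as the consecutive blocks
  \<open>t\<close> and \<open>Suc t\<close>.\<close>

lemma block_periodic: "block (Suc t) = block 1"
proof -
  have "{2 * Suc t - 1..2 * Suc t + r - 4} = (\<lambda>k. k + 2 * t) ` {2 * 1 - 1..2 * 1 + r - 4}"
    using r_ge by (subst image_add_atLeastAtMost') auto
  then have "block (Suc t) = (\<lambda>k. wrap (k + 2 * t)) ` {2 * 1 - 1..2 * 1 + r - 4}"
    by (simp only: block_eq image_image)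
  also have "\<dots> = block 1" unfolding block_eq
    by (intro image_cong) (auto simp: wrap_def simp flip: Nat.add_diff_assoc2)
  finally show ?thesis .
qed

text \<open>The union that wraps around contains \<open>2 * t\<close> but not
  \<open>2 * t - 2\<close>, since after wrapping it stops at \<open>r - 2 \<le> 2 * t - 4\<close>.
  For \<open>i < t\<close> the interval starts at or before \<open>2 * t - 3\<close>, so it cannot
  reach \<open>2 * t\<close> without passing \<open>2 * t - 2\<close>.\<close>

lemma last_Un_ne:
  assumes "i \<in> {1..t - 1}"
  shows "block t \<union> block (Suc t) \<noteq> block i \<union> block (Suc i)"
proof
  assume eq: "block t \<union> block (Suc t) = block i \<union> block (Suc i)"
  have t1: "t \<ge> 1" "i \<ge> 1" using assms by auto
  have "wrap (2 * t) = 2 * t" using t1 by (simp add: wrap_def)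
  moreover have "wrap (2 * t) \<in> wrap ` {2 * t - 1..2 * t + r - 2}" using r_ge by (intro imageI) auto
  ultimately have "2 * t \<in> block i \<union> block (Suc i)"
    using t1 by (simp flip: eq add: block_Un_block del: Un_iff)
  then obtain k where k: "k \<in> {2 * i - 1..2 * i + r - 2}" "(k - 1) mod (2 * t) = 2 * t - 1"
    using t1 by (auto simp: block_Un_block wrap_def simp del: Un_iff)
  have "k - 1 \<ge> 2 * t - 1" using k(2) mod_less_eq_dividend[of "k - 1" "2 * t"] by simp
  then have "wrap (2 * t - 2) \<in> wrap ` {2 * i - 1..2 * i + r - 2}"
    using k(1) assms by (intro imageI) auto
  moreover have "wrap (2 * t - 2) = 2 * t - 2" using t_ge by (simp add: wrap_def)
  ultimately have "2 * t - 2 \<in> block t \<union> block (Suc t)"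
    using t1 t_ge by (simp add: eq block_Un_block del: Un_iff)
  then obtain l where l: "l \<in> {2 * t - 1..2 * t + r - 2}" "(l - 1) mod (2 * t) + 1 = 2 * t - 2"
    using t1 by (auto simp: block_Un_block wrap_def simp del: Un_iff)
  show False
  proof (cases "l - 1 < 2 * t")
    case True
    then show False using l t_ge by auto
  next
    case False
    have "(l - 1) mod (2 * t) = (l - 1 - 2 * t) mod (2 * t)" using False by (metis le_mod_geq not_le)
    also have "\<dots> = l - 1 - 2 * t" using l(1) r_le t_ge by (intro mod_less) auto
    finally show False using l r_le t_ge by auto
  qed
qed

text \<open>The modulus \<open>2 * t\<close> is even.\<close>

lemma odd_wrap: "k \<ge> 1 \<Longrightarrow> odd (wrap k) \<longleftrightarrow> odd k"
  by (simp add: wrap_def dvd_mod_iff)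

text \<open>Every interval starts at an odd number and \<open>wrap\<close> keeps parity, so the odd
  elements are those at even offsets, whatever \<open>i\<close> is.\<close>

lemma card_odd_block:
  assumes "i \<ge> 1"
  shows "card {p \<in> block i. odd p} = card {k. k < r - 2 \<and> even k}"
proof -
  let ?g = "\<lambda>k. wrap (k + (2 * i - 1))"
  have "{2 * i - 1..2 * i + r - 4} = (\<lambda>k. k + (2 * i - 1)) ` {..<r - 2}"
    using assms r_ge unfolding lessThan_atLeast0 image_add_atLeastLessThan' by auto
  then have "block i = ?g ` {..<r - 2}" by (simp add: block_eq image_image)
  moreover have "odd (?g k) \<longleftrightarrow> even k" for k using assms odd_wrap[of "k + (2 * i - 1)"] by auto
  ultimately have "{p \<in> block i. odd p} = ?g ` {k. k < r - 2 \<and> even k}" by auto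
  moreover have "inj_on ?g {..<r - 2}"
  proof -
    have "inj_on wrap ((\<lambda>k. k + (2 * i - 1)) ` {..<r - 2})"
      by (rule inj_on_subset[OF inj_on_wrap[of "2 * i - 1" "2 * i + r - 4"]])
        (use assms r_ge r_le t_ge in auto)
    then show ?thesis by (simp add: inj_on_def)
  qed
  ultimately show ?thesis by (simp add: card_image inj_on_def)
qed

text \<open>All blocks contain the same number of odd elements; trading an odd element of a block for an
  even element of the next block changes this number.\<close>

lemma ex_non_block:
  assumes "i \<ge> 1"
  obtains A where "A \<subseteq> block i \<union> block (Suc i)" "card A = r - 2" "\<And>j. j \<ge> 1 \<Longrightarrow> A \<noteq> block j"
proof -
  have C: "card (block i) = r - 2" using card_block assms by blast
  define a where "a = wrap (2 * i - 1)"
  have a: "a \<in> block i" "odd a"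
    unfolding a_def block_eq using assms r_ge odd_wrap[of "2 * i - 1"] by (auto intro!: imageI)
  \<comment> \<open>The next block adds the positions \<open>2 * i + r - 3\<close> and
    \<open>2 * i + r - 2\<close>; \<open>k\<close> is the even one.\<close>
  define k where "k = (if even r then 2 * i + r - 2 else 2 * i + r - 3)"
  have k: "k \<in> {2 * i - 1..2 * i + r - 2}" "k \<notin> {2 * i - 1..2 * i + r - 4}" "even k" "k \<ge> 1"
    using assms r_ge by (auto simp: k_def)
  have b: "wrap k \<in> block i \<union> block (Suc i)" "even (wrap k)"
    using block_Un_block[OF assms] k odd_wrap[of k] by auto
  have "inj_on wrap {2 * i - 1..2 * i + r - 2}"
    using assms r_ge r_le t_ge by (intro inj_on_wrap) auto
  then have nb: "wrap k \<notin> block i" unfolding block_eq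
    using k(1,2) by (subst inj_on_image_mem_iff) auto
  define A where "A = insert (wrap k) (block i - {a})"
  have "card A = r - 2" using nb a C r_ge by (simp add: A_def)
  moreover have "A \<subseteq> block i \<union> block (Suc i)" using b by (auto simp: A_def)
  moreover have "A \<noteq> block j" if "j \<ge> 1" for j
  proof
    assume "A = block j"
    then have "card {p \<in> A. odd p} = card {p \<in> block i. odd p}"
      using card_odd_block assms that by simp
    moreover have "{p \<in> A. odd p} = {p \<in> block i. odd p} - {a}" using b by (auto simp: A_def)
    moreover have "card ({p \<in> block i. odd p} - {a}) < card {p \<in> block i. odd p}"
      using a by (intro psubset_card_mono) auto
    ultimately show False by simp
  qed
  ultimately show ?thesis using that by blast
qed

section \<open>Independent sets of K and of its contraction\<close>

abbreviation K :: "nat matroid_struct" where "K \<equiv> K_matroid r t"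

abbreviation M :: "nat matroid_struct" where "M \<equiv> contraction K (K_X t)"

lemma ground_K: "ground K = {1..2 * t + 2}"
  by (simp add: K_matroid_def matroid_of_circuits_def)

lemma block_Int_X: "block i \<inter> K_X t = {}"
  using block_subset[of i] by (auto simp: K_X_def)

lemma card_X: "card (K_X t) = 2"
  by (simp add: K_X_def)

lemma finite_X [simp]: "finite (K_X t)"
  by (simp add: K_X_def)

lemma card_circuit_hyperplane:
  assumes "D \<in> K_circuits' r t \<union> K_circuits'' r t"
  shows "card D = r"
  using assms
proof
  assume "D \<in> K_circuits' r t"
  then obtain i where "i \<ge> 1" "D = block i \<union> K_X t" by (auto simp: K_circuits'_def)
  then show ?thesis using card_block[of i] block_Int_X[of i] card_X r_ge
    by (simp add: card_Un_disjoint)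
next
  assume "D \<in> K_circuits'' r t"
  then obtain i where "i \<ge> 1" "D = block i \<union> block (Suc i)" by (auto simp: K_circuits''_def)
  then show ?thesis using card_block_Un_block by blast
qed

text \<open>The sparse paving description. A distinguished set has \<open>r\<close> elements, so one
  inside a set of size at most \<open>r\<close> is equal to it. A larger set has a subset of size
  \<open>r + 1\<close>, which is a circuit or contains a distinguished set.\<close>

lemma indep_K:
  "I \<in> indep K \<longleftrightarrow> I \<subseteq> {1..2 * t + 2} \<and> card I \<le> r \<and> I \<notin> K_circuits' r t \<union> K_circuits'' r t"
    (is "_ \<longleftrightarrow> ?R")
proof -
  have eq: "I \<in> indep K \<longleftrightarrow> I \<subseteq> {1..2 * t + 2} \<and> \<not> (\<exists>C\<in>K_circuits r t. C \<subseteq> I)"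
    by (simp add: K_matroid_def matroid_of_circuits_def)
  show ?thesis
  proof
    assume "I \<in> indep K"
    then have I: "I \<subseteq> {1..2 * t + 2}" "\<And>C. C \<in> K_circuits r t \<Longrightarrow> \<not> C \<subseteq> I" using eq by auto
    have "card I \<le> r"
    proof (rule ccontr)
      assume "\<not> card I \<le> r"
      then obtain J where J: "J \<subseteq> I" "card J = r + 1"
        by (metis Suc_eq_plus1 not_less_eq_eq obtain_subset_with_card_n)
      have "J \<notin> K_circuits r t" using I(2) J(1) by blast
      then obtain D where "D \<in> K_circuits' r t \<union> K_circuits'' r t" "D \<subseteq> J"
        using J I(1) unfolding K_circuits_def by blast
      then show False using I(2)[of D] J(1) unfolding K_circuits_def by blast
    qed
    then show ?R using I by (auto simp: K_circuits_def)
  next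
    assume R: ?R
    then have fin: "finite I" using finite_subset by blast
    have "\<not> C \<subseteq> I" if C: "C \<in> K_circuits r t" for C
    proof
      assume sub: "C \<subseteq> I"
      have "card C \<le> r" using card_mono[OF fin sub] R by linarith
      then have CH: "C \<in> K_circuits' r t \<union> K_circuits'' r t" using C by (auto simp: K_circuits_def)
      then have "C = I" using card_circuit_hyperplane R fin sub
        by (metis card_mono card_subset_eq le_antisym)
      then show False using CH R by blast
    qed
    then show "I \<in> indep K" using R eq by blast
  qed
qed

text \<open>Every distinguished set contains both elements of \<open>X\<close> or neither.\<close>

lemma indep_K_one_of_X:
  assumes "I \<subseteq> {1..2 * t + 2}" "card I \<le> r" "(2 * t + 1 \<in> I) \<noteq> (2 * t + 2 \<in> I)"
  shows "I \<in> indep K"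
proof -
  have "2 * t + 1 \<notin> block i" "2 * t + 2 \<notin> block i" for i using block_subset[of i] by auto
  then have "I \<notin> K_circuits' r t \<union> K_circuits'' r t"
    using assms(3) by (auto simp: K_circuits'_def K_circuits''_def K_X_def)
  then show ?thesis using assms indep_K by blast
qed

lemma indep_K_Un_X:
  assumes "I \<subseteq> {1..2 * t}"
  shows "I \<union> K_X t \<in> indep K \<longleftrightarrow> card I \<le> r - 2 \<and> (\<forall>i\<in>{1..t}. I \<noteq> block i)"
proof -
  have disj: "I \<inter> K_X t = {}" using assms by (auto simp: K_X_def)
  have "finite I" using assms finite_subset by blast
  then have "card (I \<union> K_X t) = card I + 2" using disj card_X by (simp add: card_Un_disjoint)
  moreover have "I \<union> K_X t \<notin> K_circuits'' r t"
  proof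
    assume "I \<union> K_X t \<in> K_circuits'' r t"
    then obtain i where "I \<union> K_X t = block i \<union> block (Suc i)" by (auto simp: K_circuits''_def)
    moreover have "2 * t + 1 \<in> K_X t" by (simp add: K_X_def)
    ultimately show False using block_Int_X by blast
  qed
  moreover have "I \<union> K_X t \<in> K_circuits' r t \<longleftrightarrow> (\<exists>i\<in>{1..t}. I = block i)"
  proof -
    have "I \<union> K_X t = block i \<union> K_X t \<longleftrightarrow> I = block i" for i using disj block_Int_X[of i] by blast
    then show ?thesis by (auto simp: K_circuits'_def)
  qed
  moreover have "I \<union> K_X t \<subseteq> {1..2 * t + 2}" using assms by (auto simp: K_X_def)
  moreover have "card I + 2 \<le> r \<longleftrightarrow> card I \<le> r - 2" using r_ge by linarith
  ultimately show ?thesis unfolding indep_K by (simp only: Un_iff) blast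
qed

lemma indep_K_of_small:
  assumes "I \<subseteq> {1..2 * t + 2}" "card I < r"
  shows "I \<in> indep K"
  using assms card_circuit_hyperplane[of I] indep_K[of I] by auto

lemma block_Un_not_indep_K:
  assumes "i \<in> {1..t - 1}"
  shows "block i \<union> block (Suc i) \<notin> indep K"
  using assms indep_K by (auto simp: K_circuits''_def)

text \<open>This is the only cyclically consecutive pair whose union was not declared a circuit; the
  contradictions at the end rest on this asymmetry.\<close>

lemma last_Un_indep_K: "block t \<union> block (Suc t) \<in> indep K"
proof -
  have "block t \<union> block (Suc t) \<notin> K_circuits'' r t"
    using last_Un_ne by (auto simp: K_circuits''_def)
  moreover have "block t \<union> block (Suc t) \<notin> K_circuits' r t"
  proof
    assume "block t \<union> block (Suc t) \<in> K_circuits' r t"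
    then obtain i where "block t \<union> block (Suc t) = block i \<union> K_X t" by (auto simp: K_circuits'_def)
    moreover have "2 * t + 1 \<in> K_X t" by (simp add: K_X_def)
    ultimately show False using block_Int_X by blast
  qed
  moreover have "block t \<union> block (Suc t) \<subseteq> {1..2 * t + 2}"
    using block_subset[of t] block_subset[of "Suc t"] by auto
  moreover have "card (block t \<union> block (Suc t)) \<le> r" using card_block_Un_block[of t] t_ge by simp
  ultimately show ?thesis using indep_K by blast
qed

lemma ground_M: "ground M = {1..2 * t}"
  by (auto simp: contraction_def matroid_of_rank_def ground_K K_X_def)

lemma indep_M:
  "I \<in> indep M \<longleftrightarrow> I \<subseteq> {1..2 * t} \<and> card I \<le> r - 2 \<and> (\<forall>i\<in>{1..t}. I \<noteq> block i)"
proof -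
  have "ground K - K_X t = {1..2 * t}" by (auto simp: ground_K K_X_def)
  moreover have "{} \<in> indep K" using indep_K_of_small[of "{}"] r_ge by simp
  moreover have "K_X t \<subseteq> {1..2 * t + 2}" by (auto simp: K_X_def)
  moreover have "K_X t \<in> indep K" using indep_K_of_small[of "K_X t"] r_ge card_X calculation by simp
  ultimately show ?thesis using indep_contraction[of K "K_X t" I] indep_K_Un_X[of I] ground_K by auto
qed

lemma empty_indep_M: "{} \<in> indep M"
  using card_block r_ge by (fastforce simp: indep_M)

lemma block_circuit_M:
  assumes "i \<in> {1..t}"
  shows "block i \<in> circuits M"
proof -
  have "D \<in> indep M" if D: "D \<subset> block i" for D
  proof -
    have "card D < r - 2"
      using psubset_card_mono[OF finite_block D] card_block[of i] assms by simp
    then show ?thesis using D block_subset[of i] card_block by (fastforce simp: indep_M)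
  qed
  then show ?thesis using assms block_subset[of i] by (auto simp: circuits_def ground_M indep_M)
qed

text \<open>Independent sets of \<open>M\<close> have at most \<open>r - 2\<close> elements, and
  \<open>ex_non_block\<close> supplies one of that size. As the union has \<open>r\<close> elements,
  consecutive blocks form a modular pair.\<close>

lemma rank_M_block_Un:
  assumes "i \<ge> 1"
  shows "rank M (block i \<union> block (Suc i)) = r - 2"
proof (rule antisym)
  let ?B = "block i \<union> block (Suc i)"
  have fin: "finite ?B" by simp
  obtain I where "I \<in> indep M" "card I = rank M ?B" using rank_attained[OF fin empty_indep_M] .
  then show "rank M ?B \<le> r - 2" by (metis indep_M)
  obtain A where A: "A \<subseteq> ?B" "card A = r - 2" "\<And>j. j \<ge> 1 \<Longrightarrow> A \<noteq> block j"
    using ex_non_block[OF assms] by metis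
  have "A \<in> indep M" using A block_subset[of i] block_subset[of "Suc i"] by (auto simp: indep_M)
  then show "r - 2 \<le> rank M ?B" using card_le_rank[OF fin] A by metis
qed

section \<open>Parallel circuits around the cycle\<close>

lemma not_isomorphic_circuit_lift:
  assumes N: "matroid N" "ground N = circuits M" and mpc: "modular_pair_condition M N"
  shows "\<not> isomorphic_lifts M (deletion K (K_X t)) (circuit_lift M N)"
proof
  assume "isomorphic_lifts M (deletion K (K_X t)) (circuit_lift M N)"
  then obtain \<phi> where \<phi>: "isomorphism \<phi> (deletion K (K_X t)) (circuit_lift M N)"
    and \<phi>M: "isomorphism \<phi> M M"
    by (auto simp: isomorphic_lifts_def)
  have "ground K - K_X t = {1..2 * t}" by (auto simp: ground_K K_X_def)
  then have lift: "I \<in> indep K \<longleftrightarrow> \<phi> ` I \<in> indep (circuit_lift M N)" if "I \<subseteq> {1..2 * t}" for I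
    using \<phi> that by (auto simp: isomorphism_def deletion_def)
  have inj: "inj_on \<phi> {1..2 * t}" using \<phi>M by (simp add: isomorphism_def bij_betw_def ground_M)
  have finM: "finite (ground M)" by (simp add: ground_M)
  have empN: "{} \<in> indep N" using N by (simp add: matroid_def)
  \<comment> \<open>As \<phi> also preserves \<open>M\<close>, the images \<open>D i\<close> are
    circuits of \<open>M\<close> whose unions have the same sizes and ranks as those of the blocks,
    so the argument can run on them.\<close>
  define D where "D i = \<phi> ` block i" for i
  have D_circuit: "D i \<in> circuits M" if "i \<in> {1..Suc t}" for i
  proof (cases "i = Suc t")
    case True
    then show ?thesis
      using block_circuit_M[of 1] t_ge circuit_isomorphism[OF \<phi>M] by (simp add: D_def block_periodic)
  next
    case False
    then show ?thesis
      using that block_circuit_M[of i] circuit_isomorphism[OF \<phi>M] by (simp add: D_def)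
  qed
  have loopless: "{D i} \<in> indep N" if "i \<in> {1..t}" for i
  proof -
    have "block i \<in> indep K"
      using that block_subset[of i] card_block[of i] r_ge by (intro indep_K_of_small) auto
    then have "D i \<in> indep (circuit_lift M N)" using lift block_subset by (simp add: D_def)
    then show ?thesis
      using circuit_indep_circuit_lift[OF finM empty_indep_M empN D_circuit] that by simp
  qed
  have pair: "block i \<union> block (Suc i) \<in> indep K \<longleftrightarrow> {D i, D (Suc i)} \<in> indep N"
    and ne: "D i \<noteq> D (Suc i)" if i: "i \<in> {1..t}" for i
  proof -
    let ?B = "block i \<union> block (Suc i)"
    have B: "?B \<subseteq> {1..2 * t}" using block_subset[of i] block_subset[of "Suc i"] by simp
    have im: "\<phi> ` ?B = D i \<union> D (Suc i)" by (simp add: D_def image_Un)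
    have cB: "card (D i \<union> D (Suc i)) = r"
      using card_image[OF inj_on_subset[OF inj B]] card_block_Un_block[of i] i im by simp
    have "card (D i) = r - 2"
      using card_image[OF inj_on_subset[OF inj block_subset]] card_block[of i] i by (simp add: D_def)
    then show ne: "D i \<noteq> D (Suc i)" using cB r_ge by auto
    have "rank M (D i \<union> D (Suc i)) = r - 2"
      using rank_isomorphism[OF \<phi>M, of ?B] B rank_M_block_Un[of i] i im by (simp add: ground_M)
    then have "D i \<union> D (Suc i) \<in> indep (circuit_lift M N) \<longleftrightarrow> {D i, D (Suc i)} \<in> indep N"
      using modular_pair_indep_circuit_lift[OF finM N mpc D_circuit D_circuit ne] i cB r_ge by simp
    then show "?B \<in> indep K \<longleftrightarrow> {D i, D (Suc i)} \<in> indep N" using lift[OF B] im by simp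
  qed
  \<comment> \<open>The equality has to be allowed: in the base case the pair collapses to
    \<open>{D 1}\<close>, which is independent.\<close>
  have "D 1 = D (Suc i) \<or> {D 1, D (Suc i)} \<notin> indep N" if "Suc i \<le> t" for i
    using that
  proof (induction i)
    case (Suc i)
    then have "Suc i \<in> {1..t - 1}" by auto
    then have "{D (Suc i), D (Suc (Suc i))} \<notin> indep N"
      using pair[of "Suc i"] block_Un_not_indep_K[of "Suc i"] by auto
    then show ?case
      using Suc parallel_trans[OF N(1) loopless[of "Suc i"], of "D 1" "D (Suc (Suc i))"] by auto
  qed simp
  from this[of "t - 1"] have "D 1 = D t \<or> {D 1, D t} \<notin> indep N" using t_ge by simp
  moreover have "D (Suc t) = D 1" by (simp add: D_def block_periodic)
  ultimately show False
    using pair[of t] ne[of t] last_Un_indep_K t_ge by (simp add: insert_commute)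
qed

section \<open>Linear relations around the cycle\<close>

lemma not_representable: "\<not> representable_over TYPE('f::field) K"
proof
  assume "representable_over TYPE('f) K"
  then obtain R :: "(nat \<Rightarrow> 'f) set" where
    R: "\<forall>c\<in>R. \<forall>d\<in>R. \<forall>\<alpha> \<beta>. (\<lambda>e. \<alpha> * c e + \<beta> * d e) \<in> R"
    and indep_R: "\<forall>I\<subseteq>{1..2 * t + 2}.
      I \<in> indep K \<longleftrightarrow> (\<forall>c\<in>R. (\<forall>e. e \<notin> I \<longrightarrow> c e = 0) \<longrightarrow> (\<forall>e. c e = 0))"
    by (rule representable_relations[of K, unfolded ground_K, OF finite_atLeastAtMost])
  have indep: "I \<in> indep K \<longleftrightarrow> (\<forall>c\<in>R. (\<forall>e. e \<notin> I \<longrightarrow> c e = 0) \<longrightarrow> (\<forall>e. c e = 0))"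
    if "I \<subseteq> {1..2 * t + 2}" for I
    using indep_R that by simp
  let ?x = "2 * t + 1" and ?y = "2 * t + 2"
  have xy: "?x \<notin> block i" "?y \<notin> block i" for i using block_subset[of i] by auto
  \<comment> \<open>Removing any element from this dependent set leaves an independent one, so a
    nonzero relation supported on it has no zero coefficient there.\<close>
  have "\<exists>c\<in>R. (\<forall>e. e \<notin> block i \<union> K_X t \<longrightarrow> c e = 0) \<and> (\<forall>e\<in>block i \<union> K_X t. c e \<noteq> 0)"
    if i: "i \<in> {1..t}" for i
  proof -
    let ?C = "block i \<union> K_X t"
    have C: "?C \<subseteq> {1..2 * t + 2}" using block_subset[of i] by (auto simp: K_X_def)
    have "?C \<in> K_circuits' r t" using i by (auto simp: K_circuits'_def)
    then have dep: "?C \<notin> indep K" and card: "card ?C = r"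
      using indep_K card_circuit_hyperplane by auto
    obtain c e' where c: "c \<in> R" "\<forall>e. e \<notin> ?C \<longrightarrow> c e = 0" "c e' \<noteq> 0"
      using dep indep[OF C] by blast
    have "c e \<noteq> 0" if e: "e \<in> ?C" for e
    proof
      assume "c e = 0"
      have "?C - {e} \<in> indep K"
        using C card e r_ge by (intro indep_K_of_small) auto
      then show False using indep[of "?C - {e}"] C c \<open>c e = 0\<close> by blast
    qed
    then show ?thesis using c by blast
  qed
  then obtain c where c: "\<And>i. i \<in> {1..t} \<Longrightarrow> c i \<in> R"
    "\<And>i e. i \<in> {1..t} \<Longrightarrow> e \<notin> block i \<union> K_X t \<Longrightarrow> c i e = 0"
    "\<And>i e. i \<in> {1..t} \<Longrightarrow> e \<in> block i \<union> K_X t \<Longrightarrow> c i e \<noteq> 0"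
    by metis
  have cx: "c i ?x \<noteq> 0" if "i \<in> {1..t}" for i using c(3)[OF that] by (simp add: K_X_def)
  \<comment> \<open>Proportionality of the coefficient pairs on \<open>X\<close>, cross-multiplied
    to avoid division.\<close>
  have step: "c (Suc i) ?x * c i ?y = c i ?x * c (Suc i) ?y" if i: "i \<in> {1..t - 1}" for i
  proof -
    let ?B = "block i \<union> block (Suc i)"
    have it: "i \<in> {1..t}" "Suc i \<in> {1..t}" using i by auto
    have B: "?B \<subseteq> {1..2 * t + 2}" using block_subset[of i] block_subset[of "Suc i"] by auto
    obtain b e where b: "b \<in> R" "\<And>e. e \<notin> ?B \<Longrightarrow> b e = 0" "b e \<noteq> 0"
      using block_Un_not_indep_K[OF i] indep[OF B] by blast
    have e: "e \<in> ?B" using b by blast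
    define d where "d = (\<lambda>p. c (Suc i) ?x * c i p + (- c i ?x) * c (Suc i) p)"
    have "d \<in> R" unfolding d_def using R c(1) it by blast
    define d' where "d' = (\<lambda>p. b e * d p + (- d e) * b p)"
    have "d' \<in> R" unfolding d'_def using R b(1) \<open>d \<in> R\<close> by blast
    \<comment> \<open>\<open>d\<close> vanishes at \<open>?x\<close>, and subtracting a multiple of \<open>b\<close> makes it vanish at \<open>e\<close> too without
      changing its value at \<open>?y\<close>.\<close>
    let ?J = "insert ?y (?B - {e})"
    \<comment> \<open>Exchanging \<open>e\<close> for \<open>?y\<close> keeps the size
      \<open>r\<close>, and \<open>?J\<close> has exactly one element of \<open>X\<close>. It is
      thus independent, and the relation \<open>d'\<close> supported on it is zero.\<close>
    have "?J \<in> indep K"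
    proof (rule indep_K_one_of_X)
      show "card ?J \<le> r"
        using e xy[of i] xy[of "Suc i"] card_block_Un_block[of i] i r_ge by simp
    qed (use B xy in auto)
    moreover have "d' p = 0" if "p \<notin> ?J" for p
    proof (cases "p = e \<or> p = ?x")
      case True
      then show ?thesis using b(2)[of ?x] xy by (auto simp: d'_def d_def algebra_simps)
    next
      case False
      then have "p \<notin> block i \<union> K_X t" "p \<notin> block (Suc i) \<union> K_X t" "p \<notin> ?B"
        using that by (auto simp: K_X_def)
      then show ?thesis using b(2) c(2)[OF it(1)] c(2)[OF it(2)] by (simp add: d'_def d_def)
    qed
    moreover have "?J \<subseteq> {1..2 * t + 2}" using B by auto
    ultimately have "d' ?y = 0" using indep[of ?J] \<open>d' \<in> R\<close> by blast
    then have "d ?y = 0" using b xy by (simp add: d'_def)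
    then show ?thesis by (simp add: d_def)
  qed
  have "c (Suc i) ?x * c 1 ?y = c 1 ?x * c (Suc i) ?y" if "Suc i \<le> t" for i
    using that
  proof (induction i)
    case (Suc i)
    then have "c (Suc i) ?x * c 1 ?y = c 1 ?x * c (Suc i) ?y" by simp
    moreover have "c (Suc (Suc i)) ?x * c (Suc i) ?y = c (Suc i) ?x * c (Suc (Suc i)) ?y"
      using step[of "Suc i"] Suc.prems by simp
    \<comment> \<open>Transitivity of proportionality holds after multiplying by the middle
      coefficient, which is nonzero and can be cancelled.\<close>
    ultimately have "c (Suc i) ?x * (c (Suc (Suc i)) ?x * c 1 ?y) =
        c (Suc i) ?x * (c 1 ?x * c (Suc (Suc i)) ?y)" by algebra
    then show ?case using cx[of "Suc i"] Suc.prems by simp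
  qed simp
  from this[of "t - 1"] have last: "c t ?x * c 1 ?y = c 1 ?x * c t ?y" using t_ge by simp
  have it: "1 \<in> {1..t}" "t \<in> {1..t}" using t_ge by auto
  let ?B = "block t \<union> block 1"
  have per: "block (Suc t) = block 1" by (rule block_periodic)
  \<comment> \<open>This combination vanishes at \<open>?x\<close> by construction and at
    \<open>?y\<close> by \<open>last\<close>. Its support therefore lies in the independent set
    \<open>?B\<close>, which forces it to be zero.\<close>
  define d where "d = (\<lambda>p. c 1 ?x * c t p + (- c t ?x) * c 1 p)"
  have "d \<in> R" unfolding d_def using R c(1) it by blast
  moreover have "d p = 0" if "p \<notin> ?B" for p
  proof (cases "p \<in> K_X t")
    case True
    then show ?thesis using last by (auto simp: d_def K_X_def)
  next
    case False
    then show ?thesis using that c(2)[OF it(1)] c(2)[OF it(2)] by (simp add: d_def)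
  qed
  moreover have "?B \<in> indep K" using last_Un_indep_K per by simp
  moreover have "?B \<subseteq> {1..2 * t + 2}" using block_subset[of t] block_subset[of 1] by auto
  ultimately have d0: "d p = 0" for p using indep[of ?B] by blast
  \<comment> \<open>At an element of \<open>block t\<close> outside \<open>block 1\<close> only
    \<open>c t\<close> contributes, so \<open>d\<close> is nonzero there.\<close>
  have "\<not> block t \<subseteq> block 1"
  proof
    assume "block t \<subseteq> block 1"
    then have "?B = block 1" by blast
    then show False using card_block_Un_block[of t] card_block[of 1] per t_ge r_ge by simp
  qed
  then obtain p where p: "p \<in> block t" "p \<notin> block 1" by blast
  then have "p \<notin> block 1 \<union> K_X t" using block_Int_X[of t] by blast
  then have "c 1 p = 0" using c(2)[OF it(1)] by blast
  then have "d p \<noteq> 0" using p c(3)[OF it(2)] cx[OF it(1)] by (simp add: d_def)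
  then show False using d0 by blast
qed

end

theorem theorem3p4:
  fixes r t :: nat
  assumes "r \<ge> 4" and "t \<ge> 3" and "r \<le> 2 * t - 2"
  shows "(\<nexists>N :: nat set matroid_struct.
            matroid N \<and>
            ground N = circuits (contraction (K_matroid r t) {2 * t + 1, 2 * t + 2}) \<and>
            modular_pair_condition (contraction (K_matroid r t) {2 * t + 1, 2 * t + 2}) N \<and>
            isomorphic_lifts (contraction (K_matroid r t) {2 * t + 1, 2 * t + 2})
              (deletion (K_matroid r t) {2 * t + 1, 2 * t + 2})
              (circuit_lift (contraction (K_matroid r t) {2 * t + 1, 2 * t + 2}) N))
         \<and> \<not> representable_over TYPE('f::field) (K_matroid r t)"
proof -
  interpret K_parameters r t using assms by unfold_locales
  show ?thesis
    using not_isomorphic_circuit_lift not_representable unfolding K_X_def by blast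
qed

end
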